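(* Let $\{D_t\}_{t\in\mathbb B}$, $D$, $\rho$ be as in the context. For every $1\le j\le m$, the $(1,0)$-vector field $V_j^{-\log(-\rho)}$ belongs to $\mathcal V_j$; that is, it is smooth up to (on a neighborhood of) $\overline D\cap(\mathbb B\times\mathbb C^n)$, it projects to $\partial/\partial t^j$, and $V_j^{-\log(-\rho)}(\rho)=0$ on $\partial D\cap(\mathbb B\times\mathbb C^n)$.
   Context: Setting. $\mathbb B$ is the unit ball in $\mathbb C^m$ with coordinates $t=(t^1,\dots,t^m)$; $\{D_t\}_{t\in\mathbb B}$ is a family of smoothly bounded strongly pseudoconvex domains in $\mathbb C^n$; $D:=\{(t,\zeta)\in\mathbb C^{m+n}:\zeta\in D_t,\ t\in\mathbb B\}$ is assumed to possess a smooth (real) defining function $\rho$ (smooth on a neighborhood of $\overline D\cap(\mathbb B\times\mathbb C^n)$, $D=\{\rho<0\}$) such that for every $t\in\mathbb B$ the restriction $\rho|_{D_t}\in C^\infty(\overline{D_t})$ is a strictly plurisubharmonic defining function of $D_t$. $P:\mathbb B\times\mathbb C^n\to\mathbb B$ is the projection. $T(\rho)$ is the space of $(1,0)$-vector fields $V$ that are smooth on a neighborhood of $\overline D\cap(\mathbb B\times\mathbb C^n)$ and such that $V(\rho)$ vanishes on $\partial D\cap(\mathbb B\times\mathbb C^n)$. $\mathcal V_j:=\{V\in T(\rho):P_*V=\partial/\partial t^j\}$. Put $\psi=-\log(-\rho)$ on $D$ and $\omega^t:=i\partial^t\bar\partial^t\psi$ ($\partial^t,\bar\partial^t$ act along the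 fibre $D_t$), a complete Kähler metric on $D_t$. $V_j^{\psi}$ is the unique $(1,0)$-vector field $V$ on $D$ with $\delta_V\omega^t=-i\bar\partial^t\psi_j$ on each fibre and $P_*V=\partial/\partial t^j$, where $\delta_V$ is contraction with $V$ and $\psi_j=\partial\psi/\partial t^j$; explicitly $V_j^\psi=\frac{\partial}{\partial t^j}-\sum_\alpha v_j^\alpha\frac{\partial}{\partial\mu^\alpha}$, $v_j^\alpha=\sum_\beta\psi_{j\bar\beta}\psi^{\bar\beta\alpha}$, with $(\psi^{\bar\beta\alpha})$ the inverse matrix of $(\psi_{\alpha\bar\beta})$, $\mu$ being the coordinate on $\mathbb C^n$. *)

theory Defs
  imports "HOL-Analysis.Analysis"
begin

text \<open>On an open set \<open>S\<close> of a finite-dimensional space, \<open>Ck_on k S f\<close> says that \<open>f\<close> is of class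
  \<open>C\<^sup>k\<close> (all iterated directional derivatives up to order \<open>k\<close> exist and are continuous).
  The definition is only meaningful for open \<open>S\<close>.\<close>

primrec Ck_on ::
  "nat \<Rightarrow> 'a::real_normed_vector set \<Rightarrow> ('a \<Rightarrow> 'b::real_normed_vector) \<Rightarrow> bool"
where
  "Ck_on 0 S f \<longleftrightarrow> continuous_on S f"
| "Ck_on (Suc k) S f \<longleftrightarrow>
     (\<forall>x\<in>S. f differentiable (at x)) \<and> (\<forall>v. Ck_on k S (\<lambda>x. frechet_derivative f (at x) v))"

definition smooth_on ::
  "'a::real_normed_vector set \<Rightarrow> ('a \<Rightarrow> 'b::real_normed_vector) \<Rightarrow> bool"
where "smooth_on S f \<longleftrightarrow> (\<forall>k. Ck_on k S f)"

text \<open>The Wirtinger derivatives with respect to \<open>z\<^sup>a\<close> and its conjugate,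
  \<open>(f\<^sub>x - \<i> f\<^sub>y) / 2\<close> and \<open>(f\<^sub>x + \<i> f\<^sub>y) / 2\<close> for \<open>z\<^sup>a = x + \<i> y\<close>.\<close>

definition wd :: "'n::finite \<Rightarrow> (complex^'n \<Rightarrow> complex) \<Rightarrow> complex^'n \<Rightarrow> complex"
where "wd a f z =
  (frechet_derivative f (at z) (axis a 1) - \<i> * frechet_derivative f (at z) (axis a \<i>)) / 2"

definition wdbar :: "'n::finite \<Rightarrow> (complex^'n \<Rightarrow> complex) \<Rightarrow> complex^'n \<Rightarrow> complex"
where "wdbar a f z =
  (frechet_derivative f (at z) (axis a 1) + \<i> * frechet_derivative f (at z) (axis a \<i>)) / 2"

text \<open>The matrix of the Levi form of a real function: row \<open>a\<close>, column \<open>b\<close> is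
  \<open>r\<close> differentiated by \<open>z\<^sup>a\<close> and by the conjugate of \<open>z\<^sup>b\<close>.\<close>

definition complex_hessian :: "(complex^'n::finite \<Rightarrow> real) \<Rightarrow> complex^'n \<Rightarrow> complex^'n^'n"
where "complex_hessian r z = (\<chi> a b. wdbar b (wd a (\<lambda>x. complex_of_real (r x))) z)"

definition levi_form :: "(complex^'n::finite \<Rightarrow> real) \<Rightarrow> complex^'n \<Rightarrow> complex^'n \<Rightarrow> real"
where "levi_form r z w =
  Re (\<Sum>a\<in>UNIV. \<Sum>b\<in>UNIV. complex_hessian r z $ a $ b * (w $ a) * cnj (w $ b))"

definition strictly_psh_on :: "(complex^'n::finite) set \<Rightarrow> (complex^'n \<Rightarrow> real) \<Rightarrow> bool"
where "strictly_psh_on S r \<longleftrightarrow> (\<forall>z\<in>S. \<forall>w. w \<noteq> 0 \<longrightarrow> levi_form r z w > 0)"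

text \<open>Neighbourhoods, and smooth defining functions, relative to an open set \<open>X\<close>: nothing is
  required over the part of the closure of \<open>G\<close> outside \<open>X\<close>. The absolute notion is
  \<open>X = UNIV\<close>.\<close>

definition nbhd_of_closure_in :: "'a::topological_space set \<Rightarrow> 'a set \<Rightarrow> 'a set \<Rightarrow> bool"
where "nbhd_of_closure_in X G N \<longleftrightarrow> open N \<and> closure G \<inter> X \<subseteq> N \<and> N \<subseteq> X"

definition smooth_defining_function_in ::
  "'a::real_normed_vector set \<Rightarrow> 'a set \<Rightarrow> ('a \<Rightarrow> real) \<Rightarrow> bool"
where "smooth_defining_function_in X G r \<longleftrightarrow>
  (\<exists>N. nbhd_of_closure_in X G N \<and> smooth_on N r \<and> G = {x\<in>N. r x < 0} \<and>
       (\<forall>x\<in>frontier G \<inter> X. frechet_derivative r (at x) \<noteq> (\<lambda>_. 0)))"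

definition smoothly_bounded_strongly_pseudoconvex_domain :: "(complex^'n::finite) set \<Rightarrow> bool"
where "smoothly_bounded_strongly_pseudoconvex_domain G \<longleftrightarrow>
  open G \<and> connected G \<and> G \<noteq> {} \<and> bounded G \<and>
  (\<exists>r. smooth_defining_function_in UNIV G r \<and>
       (\<forall>z\<in>frontier G. \<forall>w. w \<noteq> 0 \<and> (\<Sum>a\<in>UNIV. wd a (\<lambda>x. complex_of_real (r x)) z * (w $ a)) = 0
          \<longrightarrow> levi_form r z w > 0))"

abbreviation base_ball :: "(complex^'m::finite) set"  where "base_ball \<equiv> ball 0 1"

text \<open>The ambient space \<open>\<bool> \<times> \<complex>\<^sup>n\<close>, which is the domain of the projection \<open>P\<close>.\<close>

abbreviation base_cyl :: "((complex^'m::finite) \<times> (complex^'n::finite)) set"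
where "base_cyl \<equiv> base_ball \<times> UNIV"

definition total_space ::
  "(complex^'m::finite \<Rightarrow> (complex^'n::finite) set) \<Rightarrow> ((complex^'m) \<times> (complex^'n)) set"
where "total_space Dt = {(t, \<zeta>). t \<in> base_ball \<and> \<zeta> \<in> Dt t}"

text \<open>A (1,0)-vector field is given by its coefficients: \<open>V p = (a, b)\<close> stands for
  the sum of the \<open>a $ k\<close> times \<open>\<partial>/\<partial>t\<^sup>k\<close> and the \<open>b $ \<alpha>\<close> times \<open>\<partial>/\<partial>\<mu>\<^sup>\<alpha>\<close>.
  Thus \<open>P\<^sub>*V\<close> is \<open>fst \<circ> V\<close>, and \<open>\<partial>/\<partial>t\<^sup>j\<close> is \<open>axis j 1\<close>.\<close>

type_synonym ('m, 'n) vfield = "(complex^'m) \<times> (complex^'n) \<Rightarrow> (complex^'m) \<times> (complex^'n)"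

definition vf_apply ::
  "('m::finite, 'n::finite) vfield \<Rightarrow> ((complex^'m) \<times> (complex^'n) \<Rightarrow> complex)
     \<Rightarrow> (complex^'m) \<times> (complex^'n) \<Rightarrow> complex"
where "vf_apply V f = (\<lambda>(t, \<zeta>).
   (\<Sum>k\<in>UNIV. fst (V (t, \<zeta>)) $ k * wd k (\<lambda>s. f (s, \<zeta>)) t)
 + (\<Sum>\<alpha>\<in>UNIV. snd (V (t, \<zeta>)) $ \<alpha> * wd \<alpha> (\<lambda>\<xi>. f (t, \<xi>)) \<zeta>))"

text \<open>\<open>T(\<rho>)\<close>, restricted to the fields that are smooth on the given neighbourhood \<open>N\<close>;
  only the values on \<open>N\<close> matter.\<close>

definition T_on ::
  "((complex^'m::finite) \<times> (complex^'n::finite)) set \<Rightarrow> ((complex^'m) \<times> (complex^'n)) set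
    \<Rightarrow> ((complex^'m) \<times> (complex^'n) \<Rightarrow> real) \<Rightarrow> ('m, 'n) vfield set"
where "T_on N D \<rho> = {V. smooth_on N V \<and>
   (\<forall>p \<in> frontier D \<inter> base_cyl. vf_apply V (\<lambda>q. complex_of_real (\<rho> q)) p = 0)}"

definition \<V> ::
  "((complex^'m::finite) \<times> (complex^'n::finite)) set
    \<Rightarrow> ((complex^'m) \<times> (complex^'n) \<Rightarrow> real) \<Rightarrow> 'm \<Rightarrow> ('m, 'n) vfield set"
where "\<V> D \<rho> j = {V. \<exists>N. nbhd_of_closure_in base_cyl D N \<and> V \<in> T_on N D \<rho> \<and>
   (\<forall>p\<in>N. fst (V p) = axis j 1)}"

text \<open>For a function \<open>\<psi>\<close> on the total space: its Hessian along the fibre (the coefficients of the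
  form \<open>\<omega>\<^sup>t\<close> up to the factor \<open>\<i>\<close>), its derivative \<open>\<psi>\<^sub>j\<close>, and the mixed derivatives of
  \<open>\<psi>\<^sub>j\<close> by the conjugates of the fibre coordinates.\<close>

definition fibre_hessian ::
  "((complex^'m::finite) \<times> (complex^'n::finite) \<Rightarrow> real) \<Rightarrow> (complex^'m) \<times> (complex^'n)
     \<Rightarrow> complex^'n^'n"
where "fibre_hessian \<psi> = (\<lambda>(t, \<zeta>). complex_hessian (\<lambda>\<xi>. \<psi> (t, \<xi>)) \<zeta>)"

definition base_deriv ::
  "((complex^'m::finite) \<times> (complex^'n::finite) \<Rightarrow> real) \<Rightarrow> 'm \<Rightarrow> (complex^'m) \<times> (complex^'n)
     \<Rightarrow> complex"
where "base_deriv \<psi> j = (\<lambda>(t, \<zeta>). wd j (\<lambda>s. complex_of_real (\<psi> (s, \<zeta>))) t)"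

definition mixed_deriv ::
  "((complex^'m::finite) \<times> (complex^'n::finite) \<Rightarrow> real) \<Rightarrow> 'm \<Rightarrow> (complex^'m) \<times> (complex^'n)
     \<Rightarrow> complex^'n"
where "mixed_deriv \<psi> j = (\<lambda>(t, \<zeta>). \<chi> \<beta>. wdbar \<beta> (\<lambda>\<xi>. base_deriv \<psi> j (t, \<xi>)) \<zeta>)"

text \<open>\<open>V\<^sub>j\<^sup>\<psi>\<close> at the point \<open>p\<close>: the unique (1,0)-vector that projects to \<open>\<partial>/\<partial>t\<^sup>j\<close> and whose
  contraction with \<open>\<omega>\<^sup>t\<close> equals \<open>-\<i>\<close> times the antiholomorphic fibre differential of
  \<open>\<psi>\<^sub>j\<close>. Both are (0,1)-forms on the fibre and are compared coefficientwise; the contraction with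
  a fibre form involves only the \<open>\<partial>/\<partial>\<mu>\<^sup>\<alpha>\<close>-components of the vector.\<close>

definition lift_vf ::
  "((complex^'m::finite) \<times> (complex^'n::finite) \<Rightarrow> real) \<Rightarrow> 'm \<Rightarrow> ('m, 'n) vfield"
where "lift_vf \<psi> j p = (THE w. fst w = axis j 1 \<and>
   (\<forall>\<beta>. (\<Sum>\<alpha>\<in>UNIV. \<i> * fibre_hessian \<psi> p $ \<alpha> $ \<beta> * (snd w $ \<alpha>)) = - \<i> * mixed_deriv \<psi> j p $ \<beta>))"

lemma lift_vf_explicit:
  assumes "invertible (fibre_hessian \<psi> p)"
  shows "lift_vf \<psi> j p =
    (axis j 1,
     \<chi> \<alpha>. - (\<Sum>\<beta>\<in>UNIV. mixed_deriv \<psi> j p $ \<beta> * matrix_inv (fibre_hessian \<psi> p) $ \<beta> $ \<alpha>))"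
proof -
  define H where "H = fibre_hessian \<psi> p"
  define b where "b = mixed_deriv \<psi> j p"
  have "\<exists>A'. H ** A' = mat 1 \<and> A' ** H = mat 1"
    using assms by (simp add: H_def invertible_def)
  then have inv: "H ** matrix_inv H = mat 1" "matrix_inv H ** H = mat 1"
    unfolding matrix_inv_def by (metis (mono_tags, lifting) someI_ex)+
  have eq: "(\<forall>\<beta>. (\<Sum>\<alpha>\<in>UNIV. \<i> * H $ \<alpha> $ \<beta> * (x $ \<alpha>)) = - \<i> * b $ \<beta>) \<longleftrightarrow> x v* H = - b" for x
  proof -
    have "(\<Sum>\<alpha>\<in>UNIV. \<i> * H $ \<alpha> $ \<beta> * (x $ \<alpha>)) = \<i> * (x v* H) $ \<beta>" for \<beta>
      by (simp add: vector_matrix_mult_def sum_distrib_left mult_ac)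
    moreover have "- \<i> * b $ \<beta> = \<i> * (- b) $ \<beta>" for \<beta>
      by simp
    ultimately have "(\<forall>\<beta>. (\<Sum>\<alpha>\<in>UNIV. \<i> * H $ \<alpha> $ \<beta> * (x $ \<alpha>)) = - \<i> * b $ \<beta>)
        \<longleftrightarrow> (\<forall>\<beta>. (x v* H) $ \<beta> = (- b) $ \<beta>)"
      by (metis complex_i_not_zero mult_left_cancel)
    then show ?thesis
      by (simp add: vec_eq_iff)
  qed
  have sol: "x v* H = - b \<longleftrightarrow> x = (- b) v* matrix_inv H" for x
    using inv by (metis vector_matrix_mul_assoc vector_matrix_mul_rid)
  have "lift_vf \<psi> j p = (THE w. fst w = axis j 1 \<and> snd w = (- b) v* matrix_inv H)"
    unfolding lift_vf_def H_def[symmetric] b_def[symmetric] eq sol ..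
  also have "\<dots> = (axis j 1, (- b) v* matrix_inv H)"
    by (rule the_equality) (auto simp: prod_eq_iff)
  finally show ?thesis
    by (simp add: H_def b_def vector_matrix_mult_def sum_negf)
qed

end

theory Submission
  imports Defs
begin

text \<open>
  Write \<open>H\<close> for the fibrewise Levi matrix of \<open>\<rho>\<close>, \<open>g\<close> for the fibrewise gradient, and \<open>k = \<rho>\<^sub>j\<close>.
  Multiplying the system that defines \<open>V\<^sub>j\<^sup>\<psi>\<close> by \<open>- \<rho>\<close> leaves a rank-one perturbation of a system
  with matrix \<open>H\<close>. If \<open>y\<close> and \<open>z\<close> solve the latter for the right-hand sides \<open>cnj g\<close> and
  \<open>\<rho>\<^sub>j\<close> differentiated by the conjugate fibre coordinates, then the vertical part is
  \<open>(c / q) y - z\<close> with \<open>c = k - g \<cdot> z\<close> and \<open>q = \<rho> - g \<cdot> y\<close>, and the field maps \<open>\<rho>\<close> to \<open>c \<rho> / q\<close>.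
  Here \<open>g \<cdot> y\<close> is the squared length of \<open>g\<close> with respect to \<open>H\<close>, so \<open>q < 0\<close> wherever \<open>\<rho> < 0\<close> or
  \<open>g \<noteq> 0\<close>: the formula stays smooth across the boundary, where \<open>c \<rho> / q\<close> vanishes.
  This uses the hypotheses on the fibres at all points of the closure of the total space over
  the ball, hence the fibres of that closure must be the closures of the fibres.
\<close>

section \<open>Calculus of functions of class \<open>C\<^sup>k\<close>\<close>

lemma frechet_derivative_cong_open:
  assumes "open S" "x \<in> S" "\<And>y. y \<in> S \<Longrightarrow> f y = g y"
  shows "frechet_derivative f (at x) = frechet_derivative g (at x)"
proof -
  have "(f has_derivative D) (at x) \<longleftrightarrow> (g has_derivative D) (at x)" for D
    using has_derivative_transform_within_open[of f D x UNIV S g]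
      has_derivative_transform_within_open[of g D x UNIV S f] assms by auto
  then show ?thesis
    by (simp add: frechet_derivative_def)
qed

lemma differentiable_cong_open:
  assumes "open S" "x \<in> S" "\<And>y. y \<in> S \<Longrightarrow> f y = g y" "f differentiable (at x)"
  shows "g differentiable (at x)"
  using assms has_derivative_transform_within_open[of f _ x UNIV S g]
  unfolding differentiable_def by blast

lemma Ck_on_cong:
  assumes "open S" "\<And>y. y \<in> S \<Longrightarrow> f y = g y" "Ck_on k S f"
  shows "Ck_on k S g"
  using assms(2,3)
proof (induction k arbitrary: f g)
  case 0
  then show ?case using continuous_on_cong[of S S f g] by simp
next
  case (Suc k)
  have "g differentiable (at x)" if "x \<in> S" for x
    using differentiable_cong_open[OF assms(1) that, of f g] Suc.prems that
    unfolding Ck_on.simps by blast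
  moreover have "Ck_on k S (\<lambda>x. frechet_derivative g (at x) v)" for v
  proof (rule Suc.IH)
    show "Ck_on k S (\<lambda>x. frechet_derivative f (at x) v)"
      using Suc.prems by simp
    show "frechet_derivative f (at y) v = frechet_derivative g (at y) v" if "y \<in> S" for y
      using frechet_derivative_cong_open[OF assms(1) that, of f g] Suc.prems(1) by simp
  qed
  ultimately show ?case by simp
qed

lemma Ck_on_lower: "Ck_on (Suc k) S f \<Longrightarrow> Ck_on k S f"
proof (induction k arbitrary: f)
  case 0
  then show ?case
    by (auto intro!: continuous_at_imp_continuous_on differentiable_imp_continuous_within)
next
  case (Suc k)
  have "f differentiable (at x)" if "x \<in> S" for x
    using Suc.prems that unfolding Ck_on.simps by blast
  moreover have "Ck_on k S (\<lambda>x. frechet_derivative f (at x) v)" for v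
    using Suc.IH Suc.prems unfolding Ck_on.simps(2)[of "Suc k"] by blast
  ultimately show ?case
    by simp
qed

lemma Ck_on_subset: "Ck_on k S f \<Longrightarrow> T \<subseteq> S \<Longrightarrow> Ck_on k T f"
  by (induction k arbitrary: f) (auto intro: continuous_on_subset)

text \<open>Derivatives are unique, so any explicit family \<open>f'\<close> may stand for
  \<open>frechet_derivative f\<close>. The closure properties below thus reduce to differentiation
  rules.\<close>

lemma Ck_on_SucI:
  assumes "open S" "\<And>x. x \<in> S \<Longrightarrow> (f has_derivative f' x) (at x)"
    and "\<And>v. Ck_on k S (\<lambda>x. f' x v)"
  shows "Ck_on (Suc k) S f"
proof -
  have "f' x = frechet_derivative f (at x)" if "x \<in> S" for x
    using frechet_derivative_at[OF assms(2)[OF that]] .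
  then have "Ck_on k S (\<lambda>x. frechet_derivative f (at x) v)" for v
    using Ck_on_cong[OF assms(1) _ assms(3)[of v]] by simp
  then show ?thesis
    using assms(2) by (auto simp: differentiable_def)
qed

lemma Ck_on_SucD:
  assumes "Ck_on (Suc k) S f"
  shows "x \<in> S \<Longrightarrow> (f has_derivative frechet_derivative f (at x)) (at x)"
    and "Ck_on k S (\<lambda>x. frechet_derivative f (at x) v)"
  using assms by (auto simp: frechet_derivative_works[symmetric])

lemma Ck_on_const: "Ck_on k S (\<lambda>x. c)"
  by (induction k arbitrary: c) (auto simp: frechet_derivative_const)

lemma Ck_on_linear:
  assumes "open S" "bounded_linear L" "Ck_on k S f"
  shows "Ck_on k S (\<lambda>x. L (f x))"
  using assms(3)
proof (induction k arbitrary: f)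
  case 0
  then show ?case
    using bounded_linear.continuous_on[OF assms(2)] by simp
next
  case (Suc k)
  show ?case
    by (rule Ck_on_SucI[OF assms(1) bounded_linear.has_derivative[OF assms(2)]])
      (use Ck_on_SucD[OF Suc.prems] Suc.IH in blast)+
qed

lemma Ck_on_add:
  assumes "open S" "Ck_on k S f" "Ck_on k S g"
  shows "Ck_on k S (\<lambda>x. f x + g x)"
  using assms(2,3)
proof (induction k arbitrary: f g)
  case 0
  then show ?case by (simp add: continuous_on_add)
next
  case (Suc k)
  show ?case
    by (rule Ck_on_SucI[OF assms(1) has_derivative_add])
      (use Ck_on_SucD[OF Suc.prems(1)] Ck_on_SucD[OF Suc.prems(2)] Suc.IH in blast)+
qed

text \<open>The product rule returns the same bilinear form with one factor differentiated. Hence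
  the induction runs over all \<open>f\<close> and \<open>g\<close>, and the other factor is lowered
  to order \<open>k\<close>.\<close>

lemma Ck_on_bilinear:
  assumes "open S" "bounded_bilinear B" "Ck_on k S f" "Ck_on k S g"
  shows "Ck_on k S (\<lambda>x. B (f x) (g x))"
  using assms(3,4)
proof (induction k arbitrary: f g)
  case 0
  then show ?case
    using bounded_bilinear.continuous_on[OF assms(2)] by simp
next
  case (Suc k)
  note f = Ck_on_SucD[OF Suc.prems(1)] Ck_on_lower[OF Suc.prems(1)]
  note g = Ck_on_SucD[OF Suc.prems(2)] Ck_on_lower[OF Suc.prems(2)]
  show ?case
  proof (rule Ck_on_SucI[OF assms(1)])
    show "((\<lambda>x. B (f x) (g x)) has_derivative
      (\<lambda>h. B (f x) (frechet_derivative g (at x) h) + B (frechet_derivative f (at x) h) (g x))) (at x)"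
      if "x \<in> S" for x
      by (rule bounded_bilinear.FDERIV[OF assms(2) f(1)[OF that] g(1)[OF that]])
    show "Ck_on k S (\<lambda>x. B (f x) (frechet_derivative g (at x) v) + B (frechet_derivative f (at x) v) (g x))"
      for v
      by (intro Ck_on_add assms(1) Suc.IH f(2,3) g(2,3))
  qed
qed

lemma Ck_on_mult:
  fixes f g :: "'a::real_normed_vector \<Rightarrow> 'b::real_normed_algebra"
  assumes "open S" "Ck_on k S f" "Ck_on k S g"
  shows "Ck_on k S (\<lambda>x. f x * g x)"
  by (rule Ck_on_bilinear[OF assms(1) bounded_bilinear_mult assms(2,3)])

text \<open>The derivative of the inverse is a product of the inverse itself with the derivative of
  \<open>f\<close>, so the induction closes with \<open>f\<close> fixed.\<close>

lemma Ck_on_inverse: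
  fixes f :: "'a::real_normed_vector \<Rightarrow> 'b::real_normed_div_algebra"
  assumes "open S" "\<And>x. x \<in> S \<Longrightarrow> f x \<noteq> 0" "Ck_on k S f"
  shows "Ck_on k S (\<lambda>x. inverse (f x))"
  using assms(3)
proof (induction k)
  case 0
  then show ?case
    using assms(2) by (auto intro: continuous_on_inverse)
next
  case (Suc k)
  have inv: "Ck_on k S (\<lambda>x. inverse (f x))"
    using Suc.IH Ck_on_lower[OF Suc.prems] .
  show ?case
  proof (rule Ck_on_SucI[OF assms(1)])
    show "((\<lambda>x. inverse (f x)) has_derivative
      (\<lambda>h. - (inverse (f x) * frechet_derivative f (at x) h * inverse (f x)))) (at x)" if "x \<in> S" for x
      using Deriv.has_derivative_inverse[OF assms(2)[OF that] Ck_on_SucD(1)[OF Suc.prems that]] .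
    show "Ck_on k S (\<lambda>x. - (inverse (f x) * frechet_derivative f (at x) v * inverse (f x)))" for v
      by (intro Ck_on_linear[OF assms(1) bounded_linear_minus[OF bounded_linear_ident]]
          Ck_on_mult assms(1) inv Ck_on_SucD(2)[OF Suc.prems])
  qed
qed

text \<open>One differentiation removes the logarithm, so a case distinction on the order
  suffices.\<close>

lemma Ck_on_ln:
  fixes f :: "'a::real_normed_vector \<Rightarrow> real"
  assumes "open S" "\<And>x. x \<in> S \<Longrightarrow> f x > 0" "Ck_on k S f"
  shows "Ck_on k S (\<lambda>x. ln (f x))"
proof (cases k)
  case 0
  then show ?thesis
    using assms by (auto intro!: continuous_on_ln) force
next
  case (Suc l)
  note f = assms(3)[unfolded Suc]
  show ?thesis
    unfolding Suc
  proof (rule Ck_on_SucI[OF assms(1)])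
    show "((\<lambda>x. ln (f x)) has_derivative (\<lambda>h. frechet_derivative f (at x) h * inverse (f x))) (at x)"
      if "x \<in> S" for x
      using Ck_on_SucD(1)[OF f that] assms(2)[OF that]
      by (auto intro!: derivative_eq_intros simp: field_simps)
    show "Ck_on l S (\<lambda>x. frechet_derivative f (at x) v * inverse (f x))" for v
      using assms(2) by (intro Ck_on_mult Ck_on_inverse assms(1) Ck_on_SucD(2)[OF f] Ck_on_lower[OF f]) force
  qed
qed

subsection \<open>Smooth functions\<close>

lemma smooth_on_subset: "smooth_on S f \<Longrightarrow> T \<subseteq> S \<Longrightarrow> smooth_on T f"
  unfolding smooth_on_def using Ck_on_subset by blast

lemma smooth_on_cong:
  "open S \<Longrightarrow> (\<And>y. y \<in> S \<Longrightarrow> f y = g y) \<Longrightarrow> smooth_on S f \<Longrightarrow> smooth_on S g"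
  unfolding smooth_on_def using Ck_on_cong[of S f g] by blast

lemma smooth_on_imp_continuous_on: "smooth_on S f \<Longrightarrow> continuous_on S f"
  unfolding smooth_on_def using Ck_on.simps(1) by blast

lemma smooth_on_imp_differentiable: "smooth_on S f \<Longrightarrow> x \<in> S \<Longrightarrow> f differentiable (at x)"
  unfolding smooth_on_def using Ck_on.simps(2) by blast

lemma smooth_on_frechet_derivative:
  "smooth_on S f \<Longrightarrow> smooth_on S (\<lambda>x. frechet_derivative f (at x) v)"
  unfolding smooth_on_def using Ck_on.simps(2) by blast

lemma smooth_on_const: "smooth_on S (\<lambda>x. c)"
  by (simp add: smooth_on_def Ck_on_const)

lemma smooth_on_linear:
  "open S \<Longrightarrow> bounded_linear L \<Longrightarrow> smooth_on S f \<Longrightarrow> smooth_on S (\<lambda>x. L (f x))"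
  by (simp add: smooth_on_def Ck_on_linear)

lemma smooth_on_add:
  "open S \<Longrightarrow> smooth_on S f \<Longrightarrow> smooth_on S g \<Longrightarrow> smooth_on S (\<lambda>x. f x + g x)"
  by (simp add: smooth_on_def Ck_on_add)

lemma smooth_on_minus:
  "open S \<Longrightarrow> smooth_on S f \<Longrightarrow> smooth_on S (\<lambda>x. - f x)"
  by (rule smooth_on_linear[OF _ bounded_linear_minus[OF bounded_linear_ident]])

lemma smooth_on_diff:
  "open S \<Longrightarrow> smooth_on S f \<Longrightarrow> smooth_on S g \<Longrightarrow> smooth_on S (\<lambda>x. f x - g x)"
  using smooth_on_add[of S f "\<lambda>x. - g x"] smooth_on_minus by auto

lemma smooth_on_mult:
  fixes f g :: "'a::real_normed_vector \<Rightarrow> 'b::real_normed_algebra"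
  shows "open S \<Longrightarrow> smooth_on S f \<Longrightarrow> smooth_on S g \<Longrightarrow> smooth_on S (\<lambda>x. f x * g x)"
  by (simp add: smooth_on_def Ck_on_mult)

lemma smooth_on_divide:
  fixes f g :: "'a::real_normed_vector \<Rightarrow> 'b::real_normed_field"
  assumes "open S" "\<And>x. x \<in> S \<Longrightarrow> g x \<noteq> 0" "smooth_on S f" "smooth_on S g"
  shows "smooth_on S (\<lambda>x. f x / g x)"
  using assms by (simp add: smooth_on_def divide_inverse Ck_on_mult Ck_on_inverse)

lemma smooth_on_ln:
  fixes f :: "'a::real_normed_vector \<Rightarrow> real"
  shows "open S \<Longrightarrow> (\<And>x. x \<in> S \<Longrightarrow> f x > 0) \<Longrightarrow> smooth_on S f \<Longrightarrow> smooth_on S (\<lambda>x. ln (f x))"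
  by (simp add: smooth_on_def Ck_on_ln)

lemma smooth_on_sum:
  assumes "open S" "\<And>i. i \<in> I \<Longrightarrow> smooth_on S (f i)"
  shows "smooth_on S (\<lambda>x. \<Sum>i\<in>I. f i x)"
  using assms(2)
  by (induction I rule: infinite_finite_induct)
    (auto intro: smooth_on_const smooth_on_add[OF assms(1)])

lemma smooth_on_prod:
  fixes f :: "'i \<Rightarrow> 'a::real_normed_vector \<Rightarrow> 'b::real_normed_field"
  assumes "open S" "\<And>i. i \<in> I \<Longrightarrow> smooth_on S (f i)"
  shows "smooth_on S (\<lambda>x. \<Prod>i\<in>I. f i x)"
  using assms(2)
  by (induction I rule: infinite_finite_induct)
    (auto intro: smooth_on_const smooth_on_mult[OF assms(1)])

section \<open>Vector-valued maps and linear systems with smooth coefficients\<close>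

lemma smooth_on_vec_nth:
  "open S \<Longrightarrow> smooth_on S f \<Longrightarrow> smooth_on S (\<lambda>x. f x $ i)"
  by (rule smooth_on_linear[OF _ bounded_linear_vec_nth])

lemma bounded_linear_axis: "bounded_linear (axis i :: 'b::real_normed_vector \<Rightarrow> 'b^'n::finite)"
proof (rule bounded_linear_intro[where K = 1])
  fix x :: 'b
  have "norm (axis i x :: 'b^'n) \<le> (\<Sum>k\<in>UNIV. norm ((axis i x :: 'b^'n) $ k))"
    unfolding norm_vec_def by (rule L2_set_le_sum) simp
  also have "\<dots> = (\<Sum>k\<in>UNIV. if k = i then norm x else 0)"
    by (intro sum.cong) (auto simp: axis_def)
  finally show "norm (axis i x :: 'b^'n) \<le> norm x * 1"
    by simp
qed (auto simp: vec_eq_iff axis_def)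

lemma smooth_on_vec_lambda:
  fixes f :: "'i::finite \<Rightarrow> 'a::real_normed_vector \<Rightarrow> 'b::real_normed_vector"
  assumes "open S" "\<And>i. smooth_on S (f i)"
  shows "smooth_on S (\<lambda>x. \<chi> i. f i x)"
proof -
  have "(\<chi> i. f i x) = (\<Sum>i\<in>UNIV. axis i (f i x))" for x
    by (simp add: vec_eq_iff axis_def)
  then show ?thesis
    using assms by (simp add: smooth_on_sum smooth_on_linear[OF _ bounded_linear_axis])
qed

lemma smooth_on_Pair:
  assumes "open S" "smooth_on S f" "smooth_on S g"
  shows "smooth_on S (\<lambda>x. (f x, g x))"
proof -
  have "smooth_on S (\<lambda>x. (f x, 0) + (0, g x))"
    by (intro smooth_on_add smooth_on_linear[OF assms(1) _ assms(2)]
        smooth_on_linear[OF assms(1) _ assms(3)] assms(1) bounded_linear_Pair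
        bounded_linear_ident bounded_linear_zero)
  then show ?thesis by simp
qed

lemma smooth_on_det:
  fixes A :: "'a::real_normed_vector \<Rightarrow> complex^'n^'n::finite"
  assumes "open S" "\<And>i j. smooth_on S (\<lambda>x. A x $ i $ j)"
  shows "smooth_on S (\<lambda>x. det (A x))"
  unfolding det_def
  by (intro smooth_on_sum smooth_on_mult smooth_on_prod smooth_on_const assms)

text \<open>By Cramer's rule each component of \<open>y\<close> is a quotient of determinants with
  smooth entries; \<open>y\<close> itself is only given as a pointwise solution.\<close>

lemma smooth_on_linear_solution:
  fixes A :: "'a::real_normed_vector \<Rightarrow> complex^'n^'n::finite"
  assumes "open S" "\<And>i j. smooth_on S (\<lambda>x. A x $ i $ j)" "\<And>i. smooth_on S (\<lambda>x. b x $ i)"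
    and "\<And>x. x \<in> S \<Longrightarrow> det (A x) \<noteq> 0" "\<And>x. x \<in> S \<Longrightarrow> A x *v y x = b x"
  shows "smooth_on S y"
proof -
  let ?C = "\<lambda>k x. \<chi> i j. if j = k then b x $ i else A x $ i $ j"
  have "smooth_on S (\<lambda>x. \<chi> k. det (?C k x) / det (A x))"
  proof (intro smooth_on_vec_lambda smooth_on_divide smooth_on_det)
    show "smooth_on S (\<lambda>x. ?C k x $ i $ j)" for k i j
      using assms(2,3) by (cases "j = k") auto
  qed (use assms in auto)
  then show ?thesis
  proof (rule smooth_on_cong[OF assms(1), rotated])
    show "(\<chi> k. det (?C k x) / det (A x)) = y x" if "x \<in> S" for x
      using cramer[OF assms(4)[OF that], of "y x" "b x"] assms(5)[OF that] by simp
  qed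
qed

section \<open>Wirtinger derivatives on a product\<close>

text \<open>All Wirtinger derivatives of a function on the total space have this form, with
  \<open>c = - \<i>\<close> or \<open>c = \<i>\<close> and \<open>u\<close>, \<open>v\<close> the real and imaginary unit vectors of a coordinate.\<close>

definition wirt :: "complex \<Rightarrow> 'a \<Rightarrow> 'a \<Rightarrow> ('a::real_normed_vector \<Rightarrow> complex) \<Rightarrow> 'a \<Rightarrow> complex"
where "wirt c u v f p = (frechet_derivative f (at p) u + c * frechet_derivative f (at p) v) / 2"

abbreviation fwd :: "'n::finite \<Rightarrow> ('a::real_normed_vector \<times> (complex^'n) \<Rightarrow> complex) \<Rightarrow> _"
  where "fwd a \<equiv> wirt (- \<i>) (0, axis a 1) (0, axis a \<i>)"

abbreviation fwdbar :: "'n::finite \<Rightarrow> ('a::real_normed_vector \<times> (complex^'n) \<Rightarrow> complex) \<Rightarrow> _"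
  where "fwdbar a \<equiv> wirt \<i> (0, axis a 1) (0, axis a \<i>)"

abbreviation bwd :: "'m::finite \<Rightarrow> ((complex^'m) \<times> 'b::real_normed_vector \<Rightarrow> complex) \<Rightarrow> _"
  where "bwd a \<equiv> wirt (- \<i>) (axis a 1, 0) (axis a \<i>, 0)"

lemma smooth_on_wirt:
  "open S \<Longrightarrow> smooth_on S f \<Longrightarrow> smooth_on S (wirt c u v f)"
  unfolding wirt_def
  by (intro smooth_on_divide smooth_on_add smooth_on_mult smooth_on_const
      smooth_on_frechet_derivative) auto

lemma wirt_cong_open:
  "open S \<Longrightarrow> p \<in> S \<Longrightarrow> (\<And>q. q \<in> S \<Longrightarrow> f q = g q) \<Longrightarrow> wirt c u v f p = wirt c u v g p"
  unfolding wirt_def using frechet_derivative_cong_open[of S p f g] by simp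

lemma frechet_derivative_slice_snd:
  assumes "f differentiable (at (t, \<zeta>))"
  shows "frechet_derivative (\<lambda>\<xi>. f (t, \<xi>)) (at \<zeta>) v = frechet_derivative f (at (t, \<zeta>)) (0, v)"
proof -
  have "((\<lambda>\<xi>. (t, \<xi>)) has_derivative (\<lambda>v. (0, v))) (at \<zeta>)"
    by (intro has_derivative_Pair has_derivative_const has_derivative_ident)
  from diff_chain_at[OF this assms[unfolded frechet_derivative_works]]
  have "((\<lambda>\<xi>. f (t, \<xi>)) has_derivative (\<lambda>v. frechet_derivative f (at (t, \<zeta>)) (0, v))) (at \<zeta>)"
    by (simp add: o_def)
  from fun_cong[OF frechet_derivative_at[OF this], of v] show ?thesis
    by simp
qed

lemma frechet_derivative_slice_fst:
  assumes "f differentiable (at (t, \<zeta>))"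
  shows "frechet_derivative (\<lambda>s. f (s, \<zeta>)) (at t) v = frechet_derivative f (at (t, \<zeta>)) (v, 0)"
proof -
  have "((\<lambda>s. (s, \<zeta>)) has_derivative (\<lambda>v. (v, 0))) (at t)"
    by (intro has_derivative_Pair has_derivative_const has_derivative_ident)
  from diff_chain_at[OF this assms[unfolded frechet_derivative_works]]
  have "((\<lambda>s. f (s, \<zeta>)) has_derivative (\<lambda>v. frechet_derivative f (at (t, \<zeta>)) (v, 0))) (at t)"
    by (simp add: o_def)
  from fun_cong[OF frechet_derivative_at[OF this], of v] show ?thesis
    by simp
qed

lemma wd_slice_snd:
  "f differentiable (at (t, \<zeta>)) \<Longrightarrow> wd a (\<lambda>\<xi>. f (t, \<xi>)) \<zeta> = fwd a f (t, \<zeta>)"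
  by (simp add: wd_def wirt_def frechet_derivative_slice_snd)

lemma wdbar_slice_snd:
  "f differentiable (at (t, \<zeta>)) \<Longrightarrow> wdbar a (\<lambda>\<xi>. f (t, \<xi>)) \<zeta> = fwdbar a f (t, \<zeta>)"
  by (simp add: wdbar_def wirt_def frechet_derivative_slice_snd)

lemma wd_slice_fst:
  "f differentiable (at (t, \<zeta>)) \<Longrightarrow> wd a (\<lambda>s. f (s, \<zeta>)) t = bwd a f (t, \<zeta>)"
  by (simp add: wd_def wirt_def frechet_derivative_slice_fst)

lemma wdbar_cong_open:
  "open S \<Longrightarrow> z \<in> S \<Longrightarrow> (\<And>q. q \<in> S \<Longrightarrow> f q = g q) \<Longrightarrow> wdbar a f z = wdbar a g z"
  unfolding wdbar_def using frechet_derivative_cong_open[of S z f g] by simp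

lemma open_slice_snd: "open S \<Longrightarrow> open {\<xi>. (t, \<xi>) \<in> S}"
  using open_vimage[of S "Pair t"] by (simp add: vimage_def continuous_on_Pair)

lemma open_slice_fst: "open S \<Longrightarrow> open {s. (s, \<xi>) \<in> S}"
  using open_vimage[of S "\<lambda>s. (s, \<xi>)"] by (simp add: vimage_def continuous_on_Pair)

text \<open>Replaces iterated derivatives of slices by directional derivatives on the total space,
  where smoothness is available. The inner derivative has to be rewritten on an open slice before
  the outer one is taken.\<close>

lemma fibre_hessian_eq:
  assumes "open S" "p \<in> S" "smooth_on S (\<lambda>q. complex_of_real (r q))"
  shows "fibre_hessian r p $ a $ b = fwdbar b (fwd a (\<lambda>q. complex_of_real (r q))) p"
proof -
  obtain t \<zeta> where p: "p = (t, \<zeta>)" by force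
  let ?R = "\<lambda>q. complex_of_real (r q)"
  have "wdbar b (wd a (\<lambda>\<xi>. ?R (t, \<xi>))) \<zeta> = wdbar b (\<lambda>\<xi>. fwd a ?R (t, \<xi>)) \<zeta>"
    using assms p by (intro wdbar_cong_open[OF open_slice_snd[OF assms(1)]] wd_slice_snd[of ?R])
      (auto intro: smooth_on_imp_differentiable)
  also have "\<dots> = fwdbar b (fwd a ?R) p"
    using wdbar_slice_snd[of "fwd a ?R" t \<zeta> b]
      smooth_on_imp_differentiable[OF smooth_on_wirt[OF assms(1,3)] assms(2)] p by simp
  finally show ?thesis
    by (simp add: fibre_hessian_def complex_hessian_def p)
qed

lemma mixed_deriv_eq:
  assumes "open S" "p \<in> S" "smooth_on S (\<lambda>q. complex_of_real (r q))"
  shows "mixed_deriv r j p $ b = fwdbar b (bwd j (\<lambda>q. complex_of_real (r q))) p"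
proof -
  obtain t \<zeta> where p: "p = (t, \<zeta>)" by force
  let ?R = "\<lambda>q. complex_of_real (r q)"
  have "wdbar b (\<lambda>\<xi>. base_deriv r j (t, \<xi>)) \<zeta> = wdbar b (\<lambda>\<xi>. bwd j ?R (t, \<xi>)) \<zeta>"
    unfolding base_deriv_def prod.case
    using assms p by (intro wdbar_cong_open[OF open_slice_snd[OF assms(1)]] wd_slice_fst[of ?R])
      (auto intro: smooth_on_imp_differentiable)
  also have "\<dots> = fwdbar b (bwd j ?R) p"
    using wdbar_slice_snd[of "bwd j ?R" t \<zeta> b]
      smooth_on_imp_differentiable[OF smooth_on_wirt[OF assms(1,3)] assms(2)] p by simp
  finally show ?thesis
    by (simp add: mixed_deriv_def p)
qed

lemma frechet_derivative_of_real:
  assumes "r differentiable (at p)"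
  shows "frechet_derivative (\<lambda>q. complex_of_real (r q)) (at p) v = of_real (frechet_derivative r (at p) v)"
proof -
  have "((\<lambda>q. complex_of_real (r q)) has_derivative
      (\<lambda>w. of_real (frechet_derivative r (at p) w))) (at p)"
    by (rule has_derivative_of_real[OF assms[unfolded frechet_derivative_works]])
  from fun_cong[OF frechet_derivative_at[OF this], of v] show ?thesis
    by simp
qed

lemma fwdbar_of_real:
  assumes "r differentiable (at p)"
  shows "fwdbar a (\<lambda>q. complex_of_real (r q)) p = cnj (fwd a (\<lambda>q. complex_of_real (r q)) p)"
  using assms by (simp add: wirt_def frechet_derivative_of_real)

section \<open>Wirtinger derivatives of \<open>- ln (- r)\<close>\<close>

lemma wirt_const: "wirt c u v (\<lambda>q. k) p = 0"
  by (simp add: wirt_def frechet_derivative_const)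

lemma wirt_mult:
  assumes "f differentiable (at p)" "g differentiable (at p)"
  shows "wirt c u v (\<lambda>q. f q * g q) p = f p * wirt c u v g p + wirt c u v f p * g p"
proof -
  have "frechet_derivative (\<lambda>q. f q * g q) (at p) w =
      f p * frechet_derivative g (at p) w + frechet_derivative f (at p) w * g p" for w
    using fun_cong[OF frechet_derivative_at[OF
        has_derivative_mult[OF assms[unfolded frechet_derivative_works]]], of w] by simp
  then show ?thesis
    by (simp add: wirt_def field_simps)
qed

lemma wirt_inverse:
  assumes "f differentiable (at p)" "f p \<noteq> 0"
  shows "wirt c u v (\<lambda>q. inverse (f q)) p = - wirt c u v f p / (f p)\<^sup>2"
proof -
  have "frechet_derivative (\<lambda>q. inverse (f q)) (at p) w =
      - (inverse (f p) * frechet_derivative f (at p) w * inverse (f p))" for w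
    using fun_cong[OF frechet_derivative_at[OF Deriv.has_derivative_inverse[OF assms(2)
        assms(1)[unfolded frechet_derivative_works]]], of w] by simp
  then have "wirt c u v (\<lambda>q. inverse (f q)) p = - (inverse (f p) * inverse (f p) * wirt c u v f p)"
    unfolding wirt_def by (simp only:) (simp add: algebra_simps)
  then show ?thesis
    by (simp add: divide_inverse power2_eq_square)
qed

lemma wirt_neg_log:
  fixes r :: "'a::real_normed_vector \<Rightarrow> real"
  assumes "r differentiable (at p)" "r p < 0"
  shows "wirt c u v (\<lambda>q. complex_of_real (- ln (- r q))) p =
    - (wirt c u v (\<lambda>q. complex_of_real (r q)) p * inverse (complex_of_real (r p)))"
proof -
  have "((\<lambda>q. - ln (- r q)) has_derivative (\<lambda>w. - (frechet_derivative r (at p) w * inverse (r p)))) (at p)"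
    using assms(1)[unfolded frechet_derivative_works] assms(2)
    by (auto intro!: derivative_eq_intros simp: field_simps)
  then have "((\<lambda>q. complex_of_real (- ln (- r q))) has_derivative
      (\<lambda>w. of_real (- (frechet_derivative r (at p) w * inverse (r p))))) (at p)"
    by (rule has_derivative_of_real)
  from fun_cong[OF frechet_derivative_at[OF this]]
  have "frechet_derivative (\<lambda>q. complex_of_real (- ln (- r q))) (at p) w =
      - (of_real (frechet_derivative r (at p) w) * inverse (of_real (r p)))" for w
    by simp
  then show ?thesis
    unfolding wirt_def frechet_derivative_of_real[OF assms(1)]
    by (simp only:) (simp add: algebra_simps add_divide_distrib diff_divide_distrib)
qed

lemma smooth_on_of_real:
  "open S \<Longrightarrow> smooth_on S r \<Longrightarrow> smooth_on S (\<lambda>q. complex_of_real (r q))"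
  by (rule smooth_on_linear[OF _ bounded_linear_of_real])

text \<open>The first derivative is \<open>- (wirt c u v R * inverse R)\<close> on all of
  \<open>S\<close>, and the product rule does the rest. Keeping both operators general serves the
  fibre Hessian and the mixed derivatives alike.\<close>

lemma wirt_wirt_neg_log:
  fixes r :: "'a::real_normed_vector \<Rightarrow> real"
  defines "R \<equiv> \<lambda>q. complex_of_real (r q)"
  assumes "open S" "p \<in> S" "smooth_on S r" "\<And>q. q \<in> S \<Longrightarrow> r q < 0"
  shows "wirt c' u' v' (wirt c u v (\<lambda>q. complex_of_real (- ln (- r q)))) p =
    - wirt c' u' v' (wirt c u v R) p / R p + wirt c u v R p * wirt c' u' v' R p / (R p)\<^sup>2"
proof -
  have sm: "smooth_on S R"
    unfolding R_def by (rule smooth_on_of_real[OF assms(2,4)])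
  have dR: "R differentiable (at p)" "wirt c u v R differentiable (at p)"
    using smooth_on_imp_differentiable[OF sm assms(3)]
      smooth_on_imp_differentiable[OF smooth_on_wirt[OF assms(2) sm] assms(3)] .
  have ne: "R p \<noteq> 0"
    using assms(5)[OF assms(3)] by (simp add: R_def)
  have dI: "(\<lambda>q. inverse (R q)) differentiable (at p)"
    by (rule differentiable_inverse[OF dR(1) ne])
  have "wirt c' u' v' (wirt c u v (\<lambda>q. complex_of_real (- ln (- r q)))) p =
      wirt c' u' v' (\<lambda>q. - 1 * (wirt c u v R q * inverse (R q))) p"
  proof (rule wirt_cong_open[OF assms(2,3)])
    show "wirt c u v (\<lambda>q. complex_of_real (- ln (- r q))) q = - 1 * (wirt c u v R q * inverse (R q))"
      if "q \<in> S" for q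
      unfolding R_def mult_minus1
      by (rule wirt_neg_log[OF smooth_on_imp_differentiable[OF assms(4) that] assms(5)[OF that]])
  qed
  also have "\<dots> = - wirt c' u' v' (\<lambda>q. wirt c u v R q * inverse (R q)) p"
    unfolding wirt_mult[OF differentiable_const differentiable_mult[OF dR(2) dI]] wirt_const
    by simp
  also have "\<dots> = - wirt c' u' v' (wirt c u v R) p / R p + wirt c u v R p * wirt c' u' v' R p / (R p)\<^sup>2"
    unfolding wirt_mult[OF dR(2) dI] wirt_inverse[OF dR(1) ne] by (simp add: divide_inverse)
  finally show ?thesis .
qed

section \<open>Fibres of the closure of the total space\<close>

text \<open>For real \<open>r\<close> the real and imaginary parts of a Wirtinger derivative are, up
  to nonzero factors, two real partial derivatives; the directions \<open>axis a 1\<close> and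
  \<open>axis a \<i>\<close> span the fibre over the reals.\<close>

lemma frechet_derivative_fibre_eq_0:
  fixes r :: "'a::real_normed_vector \<times> (complex^'n::finite) \<Rightarrow> real"
  assumes "r differentiable (at (t, \<zeta>))"
    and "\<And>a. fwd a (\<lambda>q. complex_of_real (r q)) (t, \<zeta>) = 0"
  shows "frechet_derivative (\<lambda>\<xi>. r (t, \<xi>)) (at \<zeta>) = (\<lambda>_. 0)"
proof
  fix v :: "complex^'n"
  let ?D = "\<lambda>v. frechet_derivative r (at (t, \<zeta>)) (0, v)"
  note lin = linear_frechet_derivative[OF assms(1)]
  have D: "linear ?D"
  proof (rule linearI)
    show "?D (x + y) = ?D x + ?D y" for x y
      using linear_add[OF lin, of "(0, x)" "(0, y)"] by simp
    show "?D (c *\<^sub>R x) = c *\<^sub>R ?D x" for c x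
      using linear_scale[OF lin, of c "(0, x)"] by simp
  qed
  have "?D (axis a 1) = 0 \<and> ?D (axis a \<i>) = 0" for a
  proof -
    have "Complex (?D (axis a 1)) (- ?D (axis a \<i>)) = 0"
      using assms(2)[of a]
      by (simp add: wirt_def frechet_derivative_of_real[OF assms(1)] complex_eq_iff)
    then show ?thesis
      by (simp add: complex_eq_iff)
  qed
  then have D0: "?D (s *\<^sub>R axis a 1 + s' *\<^sub>R axis a \<i>) = 0" for a s s'
    by (simp add: linear_add[OF D] linear_scale[OF D])
  have v: "v = (\<Sum>a\<in>UNIV. Re (v $ a) *\<^sub>R axis a 1 + Im (v $ a) *\<^sub>R axis a \<i>)"
    by (simp add: vec_eq_iff axis_def complex_eq_iff if_distrib[of "\<lambda>x. _ *\<^sub>R x"]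
        sum.distrib if_distrib[of Re] if_distrib[of Im] cong: if_cong)
  have "?D v = 0"
    by (subst v) (simp only: linear_sum[OF D] D0 sum.neutral_const)
  then show "frechet_derivative (\<lambda>\<xi>. r (t, \<xi>)) (at \<zeta>) v = 0"
    by (simp add: frechet_derivative_slice_snd[OF assms(1)])
qed

lemma nonpos_on_closure:
  fixes r :: "'a::topological_space \<Rightarrow> real"
  assumes "open N" "continuous_on N r" "\<And>p. p \<in> D \<Longrightarrow> r p \<le> 0" "p \<in> N" "p \<in> closure D"
  shows "r p \<le> 0"
proof (rule ccontr)
  assume "\<not> r p \<le> 0"
  moreover have "open (N \<inter> r -` {0<..})"
    by (rule continuous_open_preimage[OF assms(2,1) open_greaterThan])
  moreover have "N \<inter> r -` {0<..} \<inter> D = {}"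
    using assms(3) by force
  ultimately show False
    using open_Int_closure_eq_empty[of "N \<inter> r -` {0<..}" D] assms(4,5) by auto
qed

text \<open>A family could a priori acquire a new component over \<open>t\<close> out of a boundary point of the
  total space outside \<open>closure (Dt t)\<close>. At such a point \<open>\<rho>\<close> vanishes to first order along
  the fibre, so these points stay away from the compact set \<open>closure (Dt t)\<close>; a thin compact
  shell between the two is missed by all nearby fibres, which are connected and hence cannot
  reach beyond the shell.\<close>

lemma closure_total_space_fibre:
  fixes Dt :: "complex^'m::finite \<Rightarrow> (complex^'n::finite) set"
    and \<rho> :: "(complex^'m) \<times> (complex^'n) \<Rightarrow> real"
  assumes dom: "\<And>t. t \<in> base_ball \<Longrightarrow>
      open (Dt t) \<and> connected (Dt t) \<and> Dt t \<noteq> {} \<and> bounded (Dt t)"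
    and N: "nbhd_of_closure_in base_cyl (total_space Dt) N" "smooth_on N \<rho>"
      "total_space Dt = {p\<in>N. \<rho> p < 0}"
    and fib: "\<And>t \<zeta>. t \<in> base_ball \<Longrightarrow> \<zeta> \<in> frontier (Dt t) \<Longrightarrow>
      frechet_derivative (\<lambda>\<xi>. \<rho> (t, \<xi>)) (at \<zeta>) \<noteq> (\<lambda>_. 0)"
    and p: "(t, \<zeta>) \<in> closure (total_space Dt)" "t \<in> base_ball"
  shows "\<zeta> \<in> closure (Dt t)"
proof (rule ccontr)
  assume out: "\<zeta> \<notin> closure (Dt t)"
  define D where "D = total_space Dt"
  define C where "C = closure (Dt t)"
  have oN: "open N" and clN: "closure D \<inter> base_cyl \<subseteq> N"
    using N(1) by (auto simp: nbhd_of_closure_in_def D_def)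
  have D_eq: "D = {p\<in>N. \<rho> p < 0}" and D_iff: "(s, \<xi>) \<in> D \<longleftrightarrow> s \<in> base_ball \<and> \<xi> \<in> Dt s" for s \<xi>
    using N(3) by (auto simp: D_def total_space_def)
  have cont: "continuous_on N \<rho>"
    using smooth_on_imp_continuous_on[OF N(2)] .
  have oD: "open D"
    using continuous_open_preimage[OF cont oN open_lessThan, of 0] by (simp add: D_eq vimage_def Int_def)
  have C: "compact C" "C \<noteq> {}" "closed C"
    using dom[OF p(2)] by (auto simp: C_def compact_closure)
  define E where "E = {\<xi>. (t, \<xi>) \<in> closure D}"
  have cE: "closed E"
    using continuous_closed_vimage[of "closure D" "Pair t"]
    by (simp add: E_def vimage_def continuous_intros)
  have EN: "(t, \<xi>) \<in> N" if "\<xi> \<in> E" for \<xi>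
    using that clN p(2) by (auto simp: E_def)
  have cont_slice: "continuous_on E (\<lambda>\<xi>. f (t, \<xi>))" if "continuous_on N f" for f :: "_ \<Rightarrow> real"
    by (rule continuous_on_compose2[OF that, of E "Pair t"]) (use EN in \<open>auto intro!: continuous_intros\<close>)
  \<comment> \<open>The points of \<open>E\<close> where \<open>\<rho>\<close> and its whole fibre
    differential vanish. The intersection over directions yields closedness, since smoothness gives
    continuity of the derivative in each fixed direction.\<close>
  define Z where "Z = {\<xi>\<in>E. \<rho> (t, \<xi>) = 0} \<inter>
    (\<Inter>v. {\<xi>\<in>E. frechet_derivative \<rho> (at (t, \<xi>)) (0, v) = 0})"
  have "closed Z"
    unfolding Z_def
    by (intro closed_Int closed_INT ballI continuous_closed_preimage_constant cE cont_slice cont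
        smooth_on_imp_continuous_on smooth_on_frechet_derivative N(2))
  have dif: "\<rho> differentiable (at (t, \<xi>))" if "\<xi> \<in> E" for \<xi>
    using smooth_on_imp_differentiable[OF N(2) EN[OF that]] .
  have nonpos: "\<rho> (t, \<xi>) \<le> 0" if "\<xi> \<in> E" for \<xi>
    using nonpos_on_closure[OF oN cont _ EN[OF that], of D] that by (auto simp: D_eq E_def)
  have "C \<inter> Z = {}"
  proof -
    have False if "\<xi> \<in> C" "\<xi> \<in> Z" for \<xi>
    proof -
      have xE: "\<xi> \<in> E" and "\<rho> (t, \<xi>) = 0"
        and D0: "\<And>v. frechet_derivative \<rho> (at (t, \<xi>)) (0, v) = 0"
        using that(2) by (auto simp: Z_def)
      then have "\<xi> \<notin> Dt t"
        using D_iff[of t \<xi>] p(2) by (auto simp: D_eq)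
      then have "\<xi> \<in> frontier (Dt t)"
        using that(1) dom[OF p(2)] by (simp add: C_def frontier_def interior_open)
      moreover have "frechet_derivative (\<lambda>\<xi>. \<rho> (t, \<xi>)) (at \<xi>) = (\<lambda>_. 0)"
        using frechet_derivative_slice_snd[OF dif[OF xE]] D0 by auto
      ultimately show False
        using fib[OF p(2)] by blast
    qed
    then show ?thesis by blast
  qed
  then obtain d where d: "d > 0" "\<And>x y. x \<in> C \<Longrightarrow> y \<in> Z \<Longrightarrow> d \<le> dist x y"
    using separate_compact_closed[OF C(1) \<open>closed Z\<close>] by blast
  \<comment> \<open>Off \<open>C\<close> the slice of \<open>\<rho>\<close> is nowhere negative, so
    a point of \<open>E\<close> outside \<open>C\<close> is a local minimum with value 0. Its fibre
    differential vanishes and it lies in \<open>Z\<close>.\<close>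
  have far: "infdist \<xi> C \<ge> d" if "\<xi> \<in> E" "\<xi> \<notin> C" for \<xi>
  proof -
    have "\<not> \<rho> (t, \<xi>) < 0"
      using that EN[OF that(1)] D_iff[of t \<xi>] closure_subset[of "Dt t"] by (auto simp: D_eq C_def)
    then have rho0: "\<rho> (t, \<xi>) = 0"
      using nonpos[OF that(1)] by simp
    let ?W = "{\<eta>. (t, \<eta>) \<in> N} - C"
    have "frechet_derivative (\<lambda>\<eta>. \<rho> (t, \<eta>)) (at \<xi>) = (\<lambda>v. 0)"
    proof (rule differential_zero_maxmin[where S = ?W])
      show "\<xi> \<in> ?W"
        using that EN by blast
      show "open ?W"
        using open_slice_snd[OF oN] C(3) by (rule open_Diff)
      show "((\<lambda>\<eta>. \<rho> (t, \<eta>)) has_derivative frechet_derivative (\<lambda>\<eta>. \<rho> (t, \<eta>)) (at \<xi>)) (at \<xi>)"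
        unfolding frechet_derivative_works[symmetric]
        using differentiable_compose[of \<rho> "Pair t" \<xi> UNIV] dif[OF that(1)]
        by (auto intro!: derivative_intros)
      have "\<rho> (t, \<eta>) \<ge> 0" if "\<eta> \<in> ?W" for \<eta>
        using that D_iff[of t \<eta>] closure_subset[of "Dt t"] by (force simp: D_eq C_def)
      then show "(\<forall>\<eta>\<in>?W. \<rho> (t, \<eta>) \<le> \<rho> (t, \<xi>)) \<or> (\<forall>\<eta>\<in>?W. \<rho> (t, \<xi>) \<le> \<rho> (t, \<eta>))"
        by (simp add: rho0)
    qed
    then have "frechet_derivative \<rho> (at (t, \<xi>)) (0, v) = 0" for v
      using frechet_derivative_slice_snd[OF dif[OF that(1)], of v] by simp
    then have "\<xi> \<in> Z"
      using that rho0 by (simp add: Z_def)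
    then show ?thesis
      using infdist_attains_inf[OF C(3,2), of \<xi>] d(2) by (metis dist_commute)
  qed
  \<comment> \<open>The shell: points of \<open>E\<close> have distance 0 or at least
    \<open>d\<close> from \<open>C\<close>, so none has distance \<open>d / 2\<close>.\<close>
  define S where "S = {\<xi>. infdist \<xi> C = d / 2}"
  have "compact S"
  proof -
    obtain B where B: "\<And>x. x \<in> C \<Longrightarrow> norm x \<le> B"
      using C(1) compact_imp_bounded bounded_iff by metis
    have "norm \<xi> \<le> B + d / 2" if "\<xi> \<in> S" for \<xi>
    proof -
      obtain x where "x \<in> C" "infdist \<xi> C = dist \<xi> x"
        using infdist_attains_inf[OF C(3,2)] by blast
      then show ?thesis
        using that B[of x] norm_triangle_sub[of \<xi> x] by (simp add: S_def dist_norm)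
    qed
    then have "bounded S"
      using bounded_iff by blast
    moreover have "closed S"
      using continuous_closed_preimage_constant[of UNIV "\<lambda>\<xi>. infdist \<xi> C" "d / 2"]
      by (simp add: S_def continuous_intros)
    ultimately show ?thesis
      by (simp add: compact_eq_bounded_closed)
  qed
  have "{t} \<times> S \<subseteq> - closure D"
  proof -
    have "\<xi> \<notin> E" if "\<xi> \<in> S" for \<xi>
    proof
      assume "\<xi> \<in> E"
      moreover have "\<xi> \<notin> C"
        using that d(1) infdist_zero[of \<xi> C] by (auto simp: S_def)
      ultimately show False
        using far[of \<xi>] that d(1) by (simp add: S_def)
    qed
    then show ?thesis by (auto simp: E_def)
  qed
  \<comment> \<open>Compactness of the shell gives one neighbourhood of \<open>t\<close> over which
    the entire shell is missed.\<close>
  then obtain X where X: "t \<in> X" "open X" "X \<times> S \<subseteq> - closure D"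
    using Elementary_Topology.tube_lemma[OF \<open>compact S\<close> open_Compl[OF closed_closure], of t D]
    by blast
  obtain \<eta> where eta: "\<eta> \<in> Dt t"
    using dom[OF p(2)] by blast
  \<comment> \<open>Over \<open>Y\<close> every fibre also contains \<open>\<eta>\<close>, a point
    of \<open>C\<close>, hence has a point on the inner side of the shell.\<close>
  define Y where "Y = X \<inter> {s. (s, \<eta>) \<in> D}"
  have "open Y"
    unfolding Y_def using X(2) open_slice_fst[OF oD] by (rule open_Int)
  have "open (Y \<times> {\<xi>. infdist \<xi> C > d / 2})"
    using \<open>open Y\<close> by (intro open_Times open_Collect_less continuous_intros)
  moreover have "(t, \<zeta>) \<in> Y \<times> {\<xi>. infdist \<xi> C > d / 2}"
    using X(1) eta p far[of \<zeta>] out d(1) D_iff[of t \<eta>] by (auto simp: Y_def E_def C_def D_def)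
  \<comment> \<open>Approximating \<open>(t, \<zeta>)\<close> from \<open>D\<close> gives a fibre
    over \<open>Y\<close> with a point \<open>\<xi>\<close> beyond the shell. The distance to
    \<open>C\<close> then takes the value \<open>d / 2\<close> on this connected fibre.\<close>
  ultimately obtain s \<xi> where s: "(s, \<xi>) \<in> D" "s \<in> Y" "infdist \<xi> C > d / 2"
    using p(1) open_Int_closure_eq_empty[of "Y \<times> {\<xi>. infdist \<xi> C > d / 2}" D]
    by (fastforce simp: D_def)
  have sb: "s \<in> base_ball" "\<xi> \<in> Dt s" "\<eta> \<in> Dt s"
    using s D_iff by (auto simp: Y_def)
  have "connected ((\<lambda>\<xi>. infdist \<xi> C) ` Dt s)"
    using dom[OF sb(1)] by (intro connected_continuous_image continuous_intros) auto
  moreover have "infdist \<eta> C = 0"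
    using eta closure_subset[of "Dt t"] by (auto simp: C_def)
  ultimately have "d / 2 \<in> (\<lambda>\<xi>. infdist \<xi> C) ` Dt s"
    using connectedD_interval[of "(\<lambda>\<xi>. infdist \<xi> C) ` Dt s" 0 "infdist \<xi> C" "d / 2"] sb s(3) d(1)
    by (metis (no_types, lifting) half_gt_zero_iff image_eqI less_imp_le)
  then obtain \<nu> where "\<nu> \<in> Dt s" "\<nu> \<in> S"
    by (auto simp: S_def)
  then have "(s, \<nu>) \<in> D" "(s, \<nu>) \<notin> closure D"
    using X(3) s(2) sb(1) D_iff by (auto simp: Y_def)
  then show False
    using closure_subset by blast
qed

section \<open>The linear system for the lift\<close>

lemma transpose_mult_nth:
  fixes H :: "complex^'n^'n::finite"
  shows "(transpose H *v w) $ b = (\<Sum>a\<in>UNIV. H $ a $ b * w $ a)"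
  by (simp add: matrix_vector_mult_def transpose_def)

lemma hermitian_sum_eq:
  fixes H :: "complex^'n^'n::finite"
  shows "(\<Sum>a\<in>UNIV. \<Sum>b\<in>UNIV. H $ a $ b * w $ a * cnj (w $ b)) =
    (\<Sum>b\<in>UNIV. (transpose H *v w) $ b * cnj (w $ b))"
  unfolding transpose_mult_nth sum_distrib_right by (rule sum.swap)

text \<open>The transpose appears because the first index of a Levi matrix belongs to the
  holomorphic derivative, which is the one contracted with \<open>w\<close>.\<close>

definition pos_def :: "complex^'n^'n::finite \<Rightarrow> bool"
where "pos_def H \<longleftrightarrow>
  (\<forall>w. w \<noteq> 0 \<longrightarrow> Re (\<Sum>b\<in>UNIV. (transpose H *v w) $ b * cnj (w $ b)) > 0)"

lemma pos_defD:
  assumes "pos_def H" "w \<noteq> 0"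
    and "(\<Sum>b\<in>UNIV. (transpose H *v w) $ b * cnj (w $ b)) = complex_of_real s"
  shows "s > 0"
  using assms(1)[unfolded pos_def_def, rule_format, OF assms(2)] unfolding assms(3) by simp

lemma pos_def_mult_eq_0:
  assumes "pos_def H" "transpose H *v w = 0"
  shows "w = 0"
  using assms by (force simp: pos_def_def)

lemma pos_def_det_nonzero:
  assumes "pos_def H"
  shows "det (transpose H) \<noteq> 0"
proof -
  have "\<exists>B. B ** transpose H = mat 1"
    using matrix_left_invertible_ker[of "transpose H"] pos_def_mult_eq_0[OF assms] by blast
  then show ?thesis
    using invertible_left_inverse invertible_det_nz by blast
qed

lemma sum_rank_one_update:
  fixes r h s :: complex
  shows "(\<Sum>a\<in>A. (- f a / r + g a * h / s) * d a) =
    - (\<Sum>a\<in>A. f a * d a) / r + (\<Sum>a\<in>A. g a * d a) * h / s"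
proof -
  have "(- f a / r + g a * h / s) * d a = - (f a * d a / r) + g a * d a * (h / s)" for a
    by (simp add: divide_inverse algebra_simps)
  then show ?thesis
    by (simp add: sum.distrib sum_negf sum_subtractf sum_divide_distrib sum_distrib_right)
qed

text \<open>The Levi matrix of \<open>- ln (- \<rho>)\<close> is \<open>- H / r + g (cnj g) / r\<^sup>2\<close> with \<open>H\<close> and \<open>g\<close> the Levi matrix
  and the gradient of \<open>\<rho>\<close>; the solution of its linear system is a combination of
  solutions for \<open>H\<close> alone, in which the singularity at \<open>r = 0\<close> cancels.\<close>

lemma neg_log_system_solution:
  fixes H :: "complex^'n^'n::finite" and g m y z :: "complex^'n" and r k :: complex
  assumes y: "transpose H *v y = (\<chi> b. cnj (g $ b))" and z: "transpose H *v z = m"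
    and q: "q = r - (\<Sum>a\<in>UNIV. g $ a * y $ a)" "q \<noteq> 0"
    and c: "c = k - (\<Sum>a\<in>UNIV. g $ a * z $ a)"
    and x: "x = (c / q) *s y - z"
  shows "k + (\<Sum>a\<in>UNIV. g $ a * x $ a) = c * r / q"
    and "r \<noteq> 0 \<Longrightarrow> (\<Sum>a\<in>UNIV. (- H $ a $ b / r + g $ a * cnj (g $ b) / r\<^sup>2) * x $ a) =
      - (- m $ b / r + k * cnj (g $ b) / r\<^sup>2)"
proof -
  let ?G = "\<Sum>a\<in>UNIV. g $ a * x $ a"
  have "?G = c / q * (\<Sum>a\<in>UNIV. g $ a * y $ a) - (\<Sum>a\<in>UNIV. g $ a * z $ a)"
    by (simp add: x right_diff_distrib sum_subtractf sum_distrib_left mult_ac)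
  \<comment> \<open>The definitions of \<open>q\<close> and \<open>c\<close> say that
    \<open>g \<cdot> y = r - q\<close> and \<open>g \<cdot> z = k - c\<close>.\<close>
  also have "\<dots> = c / q * (r - q) - (k - c)"
    using q(1) c by simp
  finally have G: "?G = c * r / q - k"
    using q(2) by (simp add: field_simps)
  then show "k + ?G = c * r / q" by simp
  have "transpose H *v x = (c / q) *s (transpose H *v y) - transpose H *v z"
    by (simp add: x matrix_vector_mult_diff_distrib vector_scalar_commute)
  then have H: "(\<Sum>a\<in>UNIV. H $ a $ b * x $ a) = c / q * cnj (g $ b) - m $ b"
    unfolding y z by (simp add: transpose_mult_nth[symmetric])
  show "(\<Sum>a\<in>UNIV. (- H $ a $ b / r + g $ a * cnj (g $ b) / r\<^sup>2) * x $ a) =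
      - (- m $ b / r + k * cnj (g $ b) / r\<^sup>2)" if "r \<noteq> 0"
  proof -
    have "(\<Sum>a\<in>UNIV. (- H $ a $ b / r + g $ a * cnj (g $ b) / r\<^sup>2) * x $ a) =
        - (\<Sum>a\<in>UNIV. H $ a $ b * x $ a) / r + ?G * cnj (g $ b) / r\<^sup>2"
      by (rule sum_rank_one_update)
    \<comment> \<open>The contributions \<open>c / q * cnj (g $ b) / r\<close> from \<open>H\<close>
      and from the rank-one term cancel.\<close>
    also have "\<dots> = - (- m $ b / r + k * cnj (g $ b) / r\<^sup>2)"
      unfolding H G using that q(2) by (simp add: field_simps power2_eq_square)
    finally show ?thesis .
  qed
qed

text \<open>Pairing the homogeneous system with \<open>cnj d\<close> equates the Levi form of
  \<open>d\<close>, positive for \<open>d \<noteq> 0\<close>, with the squared modulus of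
  \<open>g \<cdot> d\<close> divided by \<open>r\<close>, which is at most 0.\<close>

lemma neg_log_system_unique:
  fixes H :: "complex^'n^'n::finite" and g d :: "complex^'n" and r :: real
  assumes "pos_def H" "r < 0"
    and d: "\<And>b. (\<Sum>a\<in>UNIV. (- H $ a $ b / of_real r + g $ a * cnj (g $ b) / (of_real r)\<^sup>2) * d $ a) = 0"
  shows "d = 0"
proof (rule ccontr)
  assume "d \<noteq> 0"
  let ?G = "\<Sum>a\<in>UNIV. g $ a * d $ a" and ?R = "complex_of_real r"
  have eq: "(transpose H *v d) $ b = ?G * cnj (g $ b) / ?R" for b
  proof -
    have "- (\<Sum>a\<in>UNIV. H $ a $ b * d $ a) / ?R + ?G * cnj (g $ b) / ?R\<^sup>2 = 0"
      using d[of b] unfolding sum_rank_one_update .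
    then show ?thesis
      using assms(2) unfolding transpose_mult_nth by (simp add: field_simps power2_eq_square)
  qed
  have "(\<Sum>b\<in>UNIV. s * cnj (g $ b) / ?R * cnj (d $ b)) = s * cnj ?G / ?R" for s
    by (simp add: sum_distrib_left sum_divide_distrib mult_ac)
  then have "(\<Sum>b\<in>UNIV. (transpose H *v d) $ b * cnj (d $ b)) = ?G * cnj ?G / ?R"
    unfolding eq .
  also have "\<dots> = of_real ((norm ?G)\<^sup>2 / r)"
    by (simp only: of_real_divide complex_norm_square)
  finally have "(norm ?G)\<^sup>2 / r > 0"
    by (rule pos_defD[OF assms(1) \<open>d \<noteq> 0\<close>])
  moreover have "(norm ?G)\<^sup>2 / r \<le> 0"
    using assms(2) by (simp add: divide_nonneg_neg)
  ultimately show False by simp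
qed

section \<open>Extension of the lift across the boundary\<close>

text \<open>The potential \<open>- ln (- \<rho>)\<close> lives on the total space, where
  \<open>\<rho> < 0\<close>. Membership in \<open>\<V>\<close> is therefore stated for a field on a
  larger neighbourhood that agrees with the lift there.\<close>

theorem mainTheorem2:
  fixes Dt :: "complex^'m::finite \<Rightarrow> (complex^'n::finite) set"
    and \<rho> :: "(complex^'m) \<times> (complex^'n) \<Rightarrow> real"
    and j :: 'm
  assumes "\<And>t. t \<in> base_ball \<Longrightarrow> smoothly_bounded_strongly_pseudoconvex_domain (Dt t)"
    and "smooth_defining_function_in base_cyl (total_space Dt) \<rho>"
    and "\<And>t. t \<in> base_ball \<Longrightarrow> smooth_defining_function_in UNIV (Dt t) (\<lambda>\<zeta>. \<rho> (t, \<zeta>))"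
    and "\<And>t. t \<in> base_ball \<Longrightarrow> strictly_psh_on (closure (Dt t)) (\<lambda>\<zeta>. \<rho> (t, \<zeta>))"
  shows "\<exists>V \<in> \<V> (total_space Dt) \<rho> j.
           \<forall>p \<in> total_space Dt. V p = lift_vf (\<lambda>q. - ln (- \<rho> q)) j p"
proof -
  define D where "D = total_space Dt"
  define R where "R = (\<lambda>q. complex_of_real (\<rho> q))"
  obtain N where N: "nbhd_of_closure_in base_cyl D N" "smooth_on N \<rho>" "D = {p\<in>N. \<rho> p < 0}"
    using assms(2) by (auto simp: smooth_defining_function_in_def D_def)
  then have oN: "open N" and clN: "closure D \<inter> base_cyl \<subseteq> N" and N_cyl: "N \<subseteq> base_cyl"
    by (auto simp: nbhd_of_closure_in_def)
  have smR: "smooth_on N R"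
    unfolding R_def by (rule smooth_on_of_real[OF oN N(2)])
  have oD: "open D"
    using continuous_open_preimage[OF smooth_on_imp_continuous_on[OF N(2)] oN open_lessThan, of 0]
    by (simp add: N(3) vimage_def Int_def)
  have dom: "open (Dt t) \<and> connected (Dt t) \<and> Dt t \<noteq> {} \<and> bounded (Dt t)" if "t \<in> base_ball" for t
    using assms(1)[OF that] by (simp add: smoothly_bounded_strongly_pseudoconvex_domain_def)
  have fib: "frechet_derivative (\<lambda>\<xi>. \<rho> (t, \<xi>)) (at \<zeta>) \<noteq> (\<lambda>_. 0)"
    if "t \<in> base_ball" "\<zeta> \<in> frontier (Dt t)" for t \<zeta>
    using assms(3)[OF that(1)] that(2) by (auto simp: smooth_defining_function_in_def)
  \<comment> \<open>This carries the hypotheses on closed fibres to every point of the closure of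
    \<open>D\<close> over the ball.\<close>
  have clos: "\<zeta> \<in> closure (Dt t)" if "(t, \<zeta>) \<in> closure D" "t \<in> base_ball" for t \<zeta>
    using closure_total_space_fibre[OF dom N[unfolded D_def] fib that[unfolded D_def]] .

  define H where "H = (\<lambda>p. \<chi> a b. fwdbar b (fwd a R) p)"
  define g where "g = (\<lambda>p. \<chi> a. fwd a R p)"
  define k where "k = bwd j R"
  define m where "m = (\<lambda>p. \<chi> b. fwdbar b (bwd j R) p)"
  \<comment> \<open>\<open>matrix_inv\<close> makes \<open>y\<close> and \<open>z\<close> total
    functions; they solve their systems where the determinant is nonzero, and Cramer's rule will
    make them smooth there.\<close>
  define y where "y = (\<lambda>p. matrix_inv (transpose (H p)) *v (\<chi> b. cnj (g p $ b)))"
  define z where "z = (\<lambda>p. matrix_inv (transpose (H p)) *v m p)"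
  define q where "q = (\<lambda>p. R p - (\<Sum>a\<in>UNIV. g p $ a * y p $ a))"
  define c where "c = (\<lambda>p. k p - (\<Sum>a\<in>UNIV. g p $ a * z p $ a))"
  define x where "x = (\<lambda>p. (c p / q p) *s y p - z p)"
  define V :: "('m, 'n) vfield" where "V = (\<lambda>p. (axis j 1, x p))"

  have H_eq: "H p = fibre_hessian \<rho> p" if "p \<in> N" for p
    using fibre_hessian_eq[OF oN that smR[unfolded R_def]] by (simp add: H_def R_def vec_eq_iff)
  have gbar: "fwdbar b R p = cnj (g p $ b)" if "p \<in> N" for p b
    using fwdbar_of_real[OF smooth_on_imp_differentiable[OF N(2) that], of b]
    by (simp add: g_def R_def)
  have yz: "transpose (H p) *v y p = (\<chi> b. cnj (g p $ b))" "transpose (H p) *v z p = m p"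
    if "det (transpose (H p)) \<noteq> 0" for p
  proof -
    have "\<exists>A'. transpose (H p) ** A' = mat 1 \<and> A' ** transpose (H p) = mat 1"
      using that unfolding invertible_det_nz[symmetric] invertible_def .
    then have "transpose (H p) ** matrix_inv (transpose (H p)) = mat 1"
      unfolding matrix_inv_def by (metis (mono_tags, lifting) someI_ex)
    then show "transpose (H p) *v y p = (\<chi> b. cnj (g p $ b))" "transpose (H p) *v z p = m p"
      by (simp_all add: y_def z_def matrix_vector_mul_assoc)
  qed

  have pos: "pos_def (H p)" if "p \<in> closure D \<inter> base_cyl" for p
  proof -
    obtain t \<zeta> where p: "p = (t, \<zeta>)" by force
    then have "\<zeta> \<in> closure (Dt t)" "t \<in> base_ball"
      using clos that by auto
    then have "levi_form (\<lambda>\<xi>. \<rho> (t, \<xi>)) \<zeta> w > 0" if "w \<noteq> 0" for w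
      using assms(4) that by (auto simp: strictly_psh_on_def)
    moreover have "complex_hessian (\<lambda>\<xi>. \<rho> (t, \<xi>)) \<zeta> = H p"
      using H_eq that clN by (auto simp: p fibre_hessian_def)
    ultimately show ?thesis
      by (simp add: pos_def_def levi_form_def hermitian_sum_eq)
  qed
  have nonpos: "\<rho> p \<le> 0" if "p \<in> closure D \<inter> base_cyl" for p
    using nonpos_on_closure[OF oN smooth_on_imp_continuous_on[OF N(2)], of D p] that clN
    by (auto simp: N(3))
  have zero: "\<rho> p = 0" if "p \<in> closure D \<inter> base_cyl" "p \<notin> D" for p
    using nonpos[OF that(1)] that clN by (force simp: N(3))
  have q_nz: "q p \<noteq> 0" if p: "p \<in> closure D \<inter> base_cyl" for p
  proof
    assume "q p = 0"
    have pN: "p \<in> N"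
      using p clN by blast
    note y = yz(1)[OF pos_def_det_nonzero[OF pos[OF p]]]
    \<comment> \<open>The Levi form of \<open>y p\<close> is the conjugate of
      \<open>g \<cdot> y\<close>, which equals \<open>\<rho> p\<close> when \<open>q p = 0\<close>.
      As \<open>\<rho> p \<le> 0\<close>, positivity forces \<open>y p = 0\<close>, and then
      \<open>\<rho> p\<close> and \<open>g p\<close> vanish too.\<close>
    have "(\<Sum>b\<in>UNIV. (transpose (H p) *v y p) $ b * cnj (y p $ b)) =
        cnj (\<Sum>a\<in>UNIV. g p $ a * y p $ a)"
      unfolding y by simp
    also have "(\<Sum>a\<in>UNIV. g p $ a * y p $ a) = R p"
      using \<open>q p = 0\<close> by (simp add: q_def)
    also have "cnj (R p) = R p"
      by (simp add: R_def)
    finally have "y p \<noteq> 0 \<Longrightarrow> \<rho> p > 0"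
      using pos_defD[OF pos[OF p]] unfolding R_def by blast
    then have "y p = 0"
      using nonpos[OF p] by force
    then have "\<rho> p = 0" and "(\<chi> b. cnj (g p $ b)) = 0"
      using \<open>q p = 0\<close> unfolding y[symmetric] by (simp_all add: q_def R_def)
    then have "g p = 0"
      by (simp add: vec_eq_iff)
    \<comment> \<open>It remains to see that \<open>\<zeta>\<close> is a boundary point of its
      fibre, where a vanishing fibre differential contradicts \<open>fib\<close>.\<close>
    obtain t \<zeta> where tz: "p = (t, \<zeta>)" by force
    then have t: "t \<in> base_ball" and "\<zeta> \<in> closure (Dt t)"
      using clos p by auto
    moreover have "\<zeta> \<notin> Dt t"
    proof
      assume "\<zeta> \<in> Dt t"
      then have "p \<in> D"
        using t by (simp add: tz D_def total_space_def)
      then show False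
        using \<open>\<rho> p = 0\<close> by (simp add: N(3))
    qed
    ultimately have "\<zeta> \<in> frontier (Dt t)"
      using dom[OF t] by (simp add: frontier_def interior_open)
    moreover have "frechet_derivative (\<lambda>\<xi>. \<rho> (t, \<xi>)) (at \<zeta>) = (\<lambda>_. 0)"
      using smooth_on_imp_differentiable[OF N(2) pN] \<open>g p = 0\<close>
      by (intro frechet_derivative_fibre_eq_0) (auto simp: tz g_def R_def vec_eq_iff)
    ultimately show False
      using fib[OF t] by blast
  qed

  \<comment> \<open>The neighbourhood is cut in two stages: openness of \<open>q \<noteq> 0\<close>
    rests on continuity of \<open>q\<close>, obtained where the determinant is nonzero.\<close>
  define N1 where "N1 = {p\<in>N. det (transpose (H p)) \<noteq> 0}"
  define N2 where "N2 = {p\<in>N1. q p \<noteq> 0}"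
  have sm: "smooth_on N (\<lambda>p. transpose (H p) $ a $ b)" "smooth_on N (\<lambda>p. g p $ a)"
    "smooth_on N (\<lambda>p. m p $ a)" "smooth_on N k" for a b
    by (simp_all add: transpose_def H_def g_def m_def k_def smooth_on_wirt oN smR)
  have sm_gbar: "smooth_on N (\<lambda>p. (\<chi> b. cnj (g p $ b)) $ a)" for a
    using smooth_on_linear[OF oN bounded_linear_cnj sm(2)] by simp
  have "open (N \<inter> (\<lambda>p. det (transpose (H p))) -` (- {0}))"
    by (intro continuous_open_preimage smooth_on_imp_continuous_on smooth_on_det oN sm) auto
  then have oN1: "open N1"
    by (simp add: N1_def vimage_def Int_def)
  have N1_N: "N1 \<subseteq> N"
    by (auto simp: N1_def)
  note sm1 = smooth_on_subset[OF _ N1_N]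
  have y1: "smooth_on N1 y"
    by (rule smooth_on_linear_solution[OF oN1 sm1[OF sm(1)] sm1[OF sm_gbar]])
      (use yz(1) in \<open>unfold N1_def, blast+\<close>)
  have z1: "smooth_on N1 z"
    by (rule smooth_on_linear_solution[OF oN1 sm1[OF sm(1)] sm1[OF sm(3)]])
      (use yz(2) in \<open>unfold N1_def, blast+\<close>)
  have q1: "smooth_on N1 q" and c1: "smooth_on N1 c"
    unfolding q_def c_def
    by (intro smooth_on_diff smooth_on_sum smooth_on_mult smooth_on_vec_nth oN1 y1 z1
        sm1[OF smR] sm1[OF sm(2)] sm1[OF sm(4)])+
  have "open (N1 \<inter> q -` (- {0}))"
    by (intro continuous_open_preimage smooth_on_imp_continuous_on q1 oN1) auto
  then have oN2: "open N2"
    by (simp add: N2_def vimage_def Int_def)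
  have N2_N1: "N2 \<subseteq> N1"
    by (auto simp: N2_def)
  note sm2 = smooth_on_subset[OF _ N2_N1]
  have "smooth_on N2 (\<lambda>p. \<chi> a. c p / q p * y p $ a - z p $ a)"
    by (intro smooth_on_vec_lambda smooth_on_diff smooth_on_mult smooth_on_divide smooth_on_vec_nth
        oN2 sm2[OF y1] sm2[OF z1] sm2[OF c1] sm2[OF q1]) (simp add: N2_def)
  moreover have "(\<lambda>p. \<chi> a. c p / q p * y p $ a - z p $ a) = x"
    by (simp add: x_def fun_eq_iff vec_eq_iff)
  ultimately have smV: "smooth_on N2 V"
    unfolding V_def by (intro smooth_on_Pair smooth_on_const oN2) simp
  have cl2: "closure D \<inter> base_cyl \<subseteq> N2"
    using clN q_nz pos_def_det_nonzero[OF pos] by (auto simp: N2_def N1_def)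
  have nb2: "nbhd_of_closure_in base_cyl D N2"
    using oN2 cl2 N2_N1 N1_N N_cyl unfolding nbhd_of_closure_in_def by blast

  \<comment> \<open>The first identity includes the points with \<open>R p = 0\<close> and gives
    tangency; the second, away from them, is the system defining the lift.\<close>
  have sol: "k p + (\<Sum>a\<in>UNIV. g p $ a * x p $ a) = c p * R p / q p"
    "R p \<noteq> 0 \<Longrightarrow> (\<Sum>a\<in>UNIV. (- H p $ a $ b / R p + g p $ a * cnj (g p $ b) / (R p)\<^sup>2) * x p $ a) =
      - (- m p $ b / R p + k p * cnj (g p $ b) / (R p)\<^sup>2)"
    if "p \<in> N2" for p b
  proof -
    have "det (transpose (H p)) \<noteq> 0" and q: "q p \<noteq> 0"
      using that by (auto simp: N2_def N1_def)
    note nz = yz[OF this(1)]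
    have qp: "q p = R p - (\<Sum>a\<in>UNIV. g p $ a * y p $ a)"
      and cp: "c p = k p - (\<Sum>a\<in>UNIV. g p $ a * z p $ a)"
      and xp: "x p = (c p / q p) *s y p - z p"
      by (simp_all add: q_def c_def x_def)
    show "k p + (\<Sum>a\<in>UNIV. g p $ a * x p $ a) = c p * R p / q p"
      by (rule neg_log_system_solution(1)[OF nz qp q cp xp])
    show "R p \<noteq> 0 \<Longrightarrow> (\<Sum>a\<in>UNIV. (- H p $ a $ b / R p + g p $ a * cnj (g p $ b) / (R p)\<^sup>2) * x p $ a) =
      - (- m p $ b / R p + k p * cnj (g p $ b) / (R p)\<^sup>2)"
      by (rule neg_log_system_solution(2)[OF nz qp q cp xp])
  qed

  have tangent: "vf_apply V R p = 0" if p: "p \<in> frontier D \<inter> base_cyl" for p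
  proof -
    obtain t \<zeta> where tz: "p = (t, \<zeta>)" by force
    have cl: "p \<in> closure D \<inter> base_cyl" and "p \<notin> D"
      using p oD by (auto simp: frontier_def interior_open)
    have dR: "R differentiable (at (t, \<zeta>))"
      using smooth_on_imp_differentiable[OF smR] clN cl tz by blast
    have "vf_apply V R p = k p + (\<Sum>a\<in>UNIV. g p $ a * x p $ a)"
      by (simp add: vf_apply_def tz V_def wd_slice_fst[OF dR] wd_slice_snd[OF dR] k_def g_def
          axis_def if_distrib[of "\<lambda>c. c * _"] mult.commute cong: if_cong)
    also have "\<dots> = 0"
      using sol(1)[of p] cl2 cl zero[OF cl \<open>p \<notin> D\<close>] by (auto simp: R_def)
    finally show ?thesis .
  qed
  have "V \<in> \<V> D \<rho> j"
    using nb2 smV tangent unfolding \<V>_def T_on_def R_def by (auto simp: V_def)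

  moreover have "V p = lift_vf (\<lambda>q. - ln (- \<rho> q)) j p" if p: "p \<in> D" for p
  proof -
    define \<psi> where "\<psi> = (\<lambda>q. - ln (- \<rho> q))"
    have pN: "p \<in> N" and neg: "\<rho> p < 0"
      using p by (auto simp: N(3))
    then have cl: "p \<in> closure D \<inter> base_cyl"
      using p closure_subset[of D] N_cyl by blast
    have smD: "smooth_on D \<rho>"
      using smooth_on_subset[OF N(2)] by (auto simp: N(3))
    have negD: "\<rho> p < 0" if "p \<in> D" for p
      using that by (simp add: N(3))
    have sm\<psi>: "smooth_on D (\<lambda>q. complex_of_real (\<psi> q))"
      unfolding \<psi>_def using negD
      by (intro smooth_on_of_real smooth_on_minus smooth_on_ln oD smD) auto
    \<comment> \<open>Reality of \<open>\<rho>\<close> enters through \<open>gbar\<close>: the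
      conjugate derivatives become \<open>cnj g\<close>, giving the rank-one form of the algebraic
      lemmas.\<close>
    have h: "fibre_hessian \<psi> p $ a $ b = - H p $ a $ b / R p + g p $ a * cnj (g p $ b) / (R p)\<^sup>2" for a b
      using fibre_hessian_eq[OF oD p sm\<psi>, of a b] gbar[OF pN, of b]
        wirt_wirt_neg_log[OF oD p smD negD, of \<i> "(0, axis b 1)" "(0, axis b \<i>)"]
      by (simp only: \<psi>_def R_def g_def H_def vec_lambda_beta)
    have mx: "mixed_deriv \<psi> j p $ b = - m p $ b / R p + k p * cnj (g p $ b) / (R p)\<^sup>2" for b
      using mixed_deriv_eq[OF oD p sm\<psi>, of j b] gbar[OF pN, of b]
        wirt_wirt_neg_log[OF oD p smD negD, of \<i> "(0, axis b 1)" "(0, axis b \<i>)"]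
      by (simp only: \<psi>_def R_def g_def k_def m_def vec_lambda_beta)
    have "R p \<noteq> 0" "p \<in> N2"
      using neg cl cl2 by (auto simp: R_def)
    note xsol = sol(2)[OF this(2,1)]
    let ?P = "\<lambda>w. \<forall>b. (\<Sum>a\<in>UNIV. \<i> * fibre_hessian \<psi> p $ a $ b * w $ a) = - \<i> * mixed_deriv \<psi> j p $ b"
    have P: "?P w \<longleftrightarrow> (\<forall>b. (\<Sum>a\<in>UNIV. fibre_hessian \<psi> p $ a $ b * w $ a) = - mixed_deriv \<psi> j p $ b)" for w
      by (simp only: mult.assoc sum_distrib_left[symmetric] minus_mult_commute
          mult_left_cancel[OF complex_i_not_zero])
    have "lift_vf \<psi> j p = V p"
      unfolding lift_vf_def
    proof (rule the_equality)
      show "fst (V p) = axis j 1 \<and> ?P (snd (V p))"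
        unfolding P V_def snd_conv fst_conv unfolding h mx using xsol by blast
      fix w :: "(complex^'m) \<times> (complex^'n)"
      assume w: "fst w = axis j 1 \<and> ?P (snd w)"
      \<comment> \<open>The difference of two solutions solves the homogeneous system.\<close>
      have "snd w - x p = 0"
      proof (rule neg_log_system_unique[OF pos[OF cl] neg, of "g p"])
        fix b
        show "(\<Sum>a\<in>UNIV. (- H p $ a $ b / complex_of_real (\<rho> p) + g p $ a * cnj (g p $ b) /
            (complex_of_real (\<rho> p))\<^sup>2) * (snd w - x p) $ a) = 0"
          using w xsol[of b] unfolding P unfolding h mx
          by (simp add: R_def right_diff_distrib sum_subtractf)
      qed
      with w show "w = V p"
        by (simp add: V_def prod_eq_iff)
    qed
    then show ?thesis
      by (simp add: \<psi>_def)
  qed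
  ultimately show ?thesis
    unfolding D_def by blast
qed

end
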